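(* Let $X$ be a proper, irreducible, non-singular algebraic curve over a perfect field $\Bbbk$, with $\Bbbk$ algebraically closed in its function field, and let $x\in X$ be a rational point with formal parameter $z_x$. Let $V:=\Bbbk((z_x))\simeq K_x$, $V^+:=\Bbbk[[z_x]]\simeq A_x$, $V^-:=z_x^{-1}\Bbbk[z_x^{-1}]$, so $V=V^-\oplus V^+$. Let $f_1,f_2\in V\setminus\{0\}$, acting as homotheties on $V$. Then $$\mathrm{Res}_x f_1\,\mathrm{d}f_2=\mathrm{Tr}(\gamma_2\beta_1-\gamma_1\beta_2),$$ where $\gamma_i:=\pi_{V^+}\circ(f_i|_{V^-})$, $\beta_i:=\pi_{V^-}\circ(f_i|_{V^+})$, and $\pi_{V^+},\pi_{V^-}$ denote the projections of $V=V^-\oplus V^+$ onto $V^+$ and $V^-$.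
   Context: $A_x=\widehat{\mathcal{O}}_{X,x}$ is the completed local ring at $x$ and $K_x$ its fraction field. $\mathrm{Res}_x f_1\,\mathrm{d}f_2$ is the coefficient of $z_x^{-1}$ in $f_1\cdot\frac{\mathrm{d}f_2}{\mathrm{d}z_x}$. The maps $\beta_i:V^+\to V^-$ have finite rank, and $\mathrm{Tr}$ is the trace of the finite rank endomorphism $\gamma_2\beta_1-\gamma_1\beta_2$ of $V^+$. *)

theory Defs
  imports "HOL-Computational_Algebra.Computational_Algebra"
begin

text \<open>
  A proper, irreducible, non-singular curve \<open>X\<close> over \<open>k\<close> is given by its function field, an
  extension \<open>\<iota> : k \<rightarrow> F\<close>. Its closed points \<open>x\<close> are the normalised discrete valuations of \<open>F\<close> that
  are trivial on \<open>k\<close>: the local rings at closed points are discrete valuation rings because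
  \<open>X\<close> is non-singular of dimension one, and every discrete valuation ring of \<open>F/k\<close> occurs
  exactly once because \<open>X\<close> is proper.
\<close>

definition perfect_field :: "'k::field itself \<Rightarrow> bool" where
  "perfect_field _ \<longleftrightarrow> (\<forall>p::'k poly. irreducible p \<longrightarrow> coprime p (pderiv p))"

definition field_hom :: "('a::field \<Rightarrow> 'b::field) \<Rightarrow> bool" where
  "field_hom h \<longleftrightarrow> h 1 = 1 \<and> (\<forall>a b. h (a + b) = h a + h b) \<and> (\<forall>a b. h (a * b) = h a * h b)"

definition algebraic_over :: "('k::field \<Rightarrow> 'F::field) \<Rightarrow> 'F \<Rightarrow> bool" where
  "algebraic_over \<iota> a \<longleftrightarrow> (\<exists>p. p \<noteq> 0 \<and> poly (map_poly \<iota> p) a = 0)"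

definition rational_functions_in :: "('k::field \<Rightarrow> 'F::field) \<Rightarrow> 'F \<Rightarrow> 'F set" where
  "rational_functions_in \<iota> t =
     {poly (map_poly \<iota> p) t / poly (map_poly \<iota> q) t | p q. poly (map_poly \<iota> q) t \<noteq> 0}"

text \<open>Finitely generated of transcendence degree one: finite over \<open>k(t)\<close> for a transcendental \<open>t\<close>.\<close>

definition function_field :: "('k::field \<Rightarrow> 'F::field) \<Rightarrow> bool" where
  "function_field \<iota> \<longleftrightarrow> field_hom \<iota> \<and>
     (\<exists>t. \<not> algebraic_over \<iota> t \<and>
       (\<exists>B. finite B \<and> (\<forall>f. \<exists>r. (\<forall>b\<in>B. r b \<in> rational_functions_in \<iota> t) \<and> f = (\<Sum>b\<in>B. r b * b))))"

definition algebraically_closed_in :: "('k::field \<Rightarrow> 'F::field) \<Rightarrow> bool" where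
  "algebraically_closed_in \<iota> \<longleftrightarrow> (\<forall>a. algebraic_over \<iota> a \<longrightarrow> a \<in> range \<iota>)"

text \<open>The value of \<open>x\<close> at \<open>0\<close> is irrelevant; it stands for \<open>\<infinity>\<close>.\<close>

definition curve_point :: "('k::field \<Rightarrow> 'F::field) \<Rightarrow> ('F \<Rightarrow> int) \<Rightarrow> bool" where
  "curve_point \<iota> x \<longleftrightarrow>
     (\<forall>a b. a \<noteq> 0 \<longrightarrow> b \<noteq> 0 \<longrightarrow> x (a * b) = x a + x b) \<and>
     (\<forall>a b. a \<noteq> 0 \<longrightarrow> b \<noteq> 0 \<longrightarrow> a + b \<noteq> 0 \<longrightarrow> min (x a) (x b) \<le> x (a + b)) \<and>
     (\<exists>t. t \<noteq> 0 \<and> x t = 1) \<and>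
     (\<forall>c. c \<noteq> 0 \<longrightarrow> x (\<iota> c) = 0)"

definition local_ring :: "('F::field \<Rightarrow> int) \<Rightarrow> 'F set" where
  "local_ring x = {a. a = 0 \<or> 0 \<le> x a}"

text \<open>The power \<open>\<mm>\<^sub>x\<^sup>n\<close> of the maximal ideal.\<close>

definition max_ideal_power :: "('F::field \<Rightarrow> int) \<Rightarrow> nat \<Rightarrow> 'F set" where
  "max_ideal_power x n = {a. a = 0 \<or> int n \<le> x a}"

definition rational_point :: "('k::field \<Rightarrow> 'F::field) \<Rightarrow> ('F \<Rightarrow> int) \<Rightarrow> bool" where
  "rational_point \<iota> x \<longleftrightarrow> curve_point \<iota> x \<and>
     (\<forall>a\<in>local_ring x. \<exists>c. a - \<iota> c \<in> max_ideal_power x 1)"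

text \<open>
  The ideal \<open>\<mm>\<^sub>x\<^sup>n A\<close> of an extension \<open>A\<close> of the local ring; products suffice, since
  \<open>\<mm>\<^sub>x\<^sup>n\<close> is principal.
\<close>

definition extended_ideal :: "('F::field \<Rightarrow> int) \<Rightarrow> ('F \<Rightarrow> 'K::field) \<Rightarrow> 'K set \<Rightarrow> nat \<Rightarrow> 'K set" where
  "extended_ideal x j A n = {j b * a | b a. b \<in> max_ideal_power x n \<and> a \<in> A}"

text \<open>
  \<open>A \<subseteq> K\<close> is (via \<open>j\<close>) the completion of the local ring \<open>\<O>\<^sub>x\<close>, and \<open>K\<close> is its fraction field.
  The second and third line of the completion property say that
  \<open>\<O>\<^sub>x / \<mm>\<^sub>x\<^sup>n \<rightarrow> A / \<mm>\<^sub>x\<^sup>n A\<close> is an isomorphism for all \<open>n\<close>, the last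
  one that \<open>A\<close> is the inverse limit of these quotients.
\<close>

definition completed_local_ring :: "('F::field \<Rightarrow> int) \<Rightarrow> ('F \<Rightarrow> 'K::field) \<Rightarrow> 'K set \<Rightarrow> bool" where
  "completed_local_ring x j A \<longleftrightarrow>
     field_hom j \<and> 1 \<in> A \<and> (\<forall>a\<in>A. \<forall>b\<in>A. a - b \<in> A \<and> a * b \<in> A) \<and> j ` local_ring x \<subseteq> A \<and>
     (\<forall>n. \<forall>b\<in>local_ring x. j b \<in> extended_ideal x j A n \<longrightarrow> b \<in> max_ideal_power x n) \<and>
     (\<forall>n. \<forall>a\<in>A. \<exists>b\<in>local_ring x. a - j b \<in> extended_ideal x j A n) \<and>
     (\<forall>s. (\<forall>n. s n \<in> local_ring x \<and> s (Suc n) - s n \<in> max_ideal_power x n) \<longrightarrow>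
       (\<exists>!a. a \<in> A \<and> (\<forall>n. a - j (s n) \<in> extended_ideal x j A n)))"

definition fraction_field_of :: "'K::field set \<Rightarrow> bool" where
  "fraction_field_of A \<longleftrightarrow> (\<forall>f. \<exists>a\<in>A. \<exists>b\<in>A. b \<noteq> 0 \<and> f = a / b)"

text \<open>A generator of the maximal ideal, the set of non-units of \<open>A\<close>.\<close>

definition formal_parameter :: "'K::field set \<Rightarrow> 'K \<Rightarrow> bool" where
  "formal_parameter A z \<longleftrightarrow> {z * a | a. a \<in> A} = {a \<in> A. a = 0 \<or> inverse a \<notin> A}"

text \<open>
  \<open>f = \<Sum>\<^sub>n c(g\<^sub>n) z\<^sup>n\<close> in the \<open>z\<close>-adic topology; here \<open>c\<close> is the inclusion of the constants.
\<close>

definition has_laurent_expansion_in ::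
  "'K::field set \<Rightarrow> ('k::field \<Rightarrow> 'K) \<Rightarrow> 'K \<Rightarrow> 'K \<Rightarrow> 'k fls \<Rightarrow> bool" where
  "has_laurent_expansion_in A c z f g \<longleftrightarrow>
     (\<forall>N. \<exists>a\<in>A. f - (\<Sum>n=fls_subdegree g..N. c (fls_nth g n) * z powi n) = z powi (N + 1) * a)"

text \<open>
  The identification \<open>K\<^sub>x \<simeq> k((z\<^sub>x))\<close>. At a rational point with formal parameter \<open>z\<close> every
  element of \<open>K\<^sub>x\<close> has exactly one expansion.
\<close>

definition laurent_expansion ::
  "'K::field set \<Rightarrow> ('k::field \<Rightarrow> 'K) \<Rightarrow> 'K \<Rightarrow> 'K \<Rightarrow> 'k fls" where
  "laurent_expansion A c z f = (THE g. has_laurent_expansion_in A c z f g)"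

text \<open>The coefficient of \<open>z\<^sup>-\<^sup>1\<close> in \<open>f\<^sub>1 \<cdot> df\<^sub>2/dz\<close>.\<close>

definition residue ::
  "'K::field set \<Rightarrow> ('k::field \<Rightarrow> 'K) \<Rightarrow> 'K \<Rightarrow> 'K \<Rightarrow> 'K \<Rightarrow> 'k" where
  "residue A c z f\<^sub>1 f\<^sub>2 =
     fls_residue (laurent_expansion A c z f\<^sub>1 * fls_deriv (laurent_expansion A c z f\<^sub>2))"

text \<open>\<open>V = k((z))\<close> is the type of formal Laurent series, with \<open>z\<close> the series \<open>fls_X\<close>.\<close>

definition V_plus :: "'k::field fls set" where
  "V_plus = range fps_to_fls"

definition V_minus :: "'k::field fls set" where
  "V_minus = {fls_X_inv * poly (map_poly fls_const p) fls_X_inv | p. True}"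

definition projection_along :: "'a::ab_group_add set \<Rightarrow> 'a set \<Rightarrow> 'a \<Rightarrow> 'a" where
  "projection_along A B v = (THE a. a \<in> A \<and> v - a \<in> B)"

definition proj_plus :: "'k::field fls \<Rightarrow> 'k fls" where
  "proj_plus = projection_along V_plus V_minus"

definition proj_minus :: "'k::field fls \<Rightarrow> 'k fls" where
  "proj_minus = projection_along V_minus V_plus"

text \<open>
  Maps defined on a subspace are total functions here; only their values on \<open>V\<^sup>-\<close> (for \<open>\<gamma>\<close>)
  respectively \<open>V\<^sup>+\<close> (for \<open>\<beta>\<close>) are used.
\<close>

definition gamma :: "'k::field fls \<Rightarrow> 'k fls \<Rightarrow> 'k fls" where
  "gamma f v = proj_plus (f * v)"

definition beta :: "'k::field fls \<Rightarrow> 'k fls \<Rightarrow> 'k fls" where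
  "beta f v = proj_minus (f * v)"

definition fls_scale :: "'k::field \<Rightarrow> 'k fls \<Rightarrow> 'k fls" where
  "fls_scale c f = fls_const c * f"

text \<open>
  The trace of an endomorphism \<open>T\<close> of the subspace \<open>W\<close> with finite-dimensional image \<open>T W\<close>
  is the trace of its restriction to \<open>T W\<close>.
\<close>

definition (in vector_space) finite_rank_trace :: "'b set \<Rightarrow> ('b \<Rightarrow> 'b) \<Rightarrow> 'a" where
  "finite_rank_trace W T =
     (let B = (SOME B. independent B \<and> span B = T ` W) in \<Sum>b\<in>B. representation B (T b) b)"

global_interpretation fls: vector_space fls_scale
  defines fls_finite_rank_trace = fls.finite_rank_trace
  by unfold_locales (simp_all add: fls_scale_def algebra_simps flip: fls_plus_const)

end

theory Submission
  imports Defs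
begin

text \<open>
  The residue formula is an identity between the coefficients of two Laurent series \<open>f\<close> and \<open>g\<close>,
  the expansions of \<open>f\<^sub>1\<close> and \<open>f\<^sub>2\<close>. Let no exponent below \<open>- N\<close> occur in \<open>f\<close> or \<open>g\<close>. Then
  multiplication by \<open>f\<close> or \<open>g\<close> maps \<open>z\<^sup>N V\<^sup>+\<close> into \<open>V\<^sup>+\<close>, so \<open>\<beta>\<^sub>1\<close> and \<open>\<beta>\<^sub>2\<close> vanish on
  \<open>z\<^sup>N V\<^sup>+\<close>, and \<open>T = \<gamma>\<^sub>2 \<beta>\<^sub>1 - \<gamma>\<^sub>1 \<beta>\<^sub>2\<close> factors through \<open>V\<^sup>+ / z\<^sup>N V\<^sup>+\<close>, which has the
  basis \<open>1, z, \<dots>, z\<^sup>N\<^sup>-\<^sup>1\<close>. The image of \<open>T\<close> need not consist of polynomials, because \<open>f\<close> and \<open>g\<close>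
  may have infinite tails; still its trace is the sum of the \<open>N\<close> diagonal coefficients of \<open>T\<close> at these
  monomials, by \<open>finite_rank_trace_eq_sum\<close>.

  The monomial \<open>z\<^sup>k\<close> returns to itself under \<open>\<gamma>\<^sub>2 \<beta>\<^sub>1\<close> by way of \<open>z\<^sup>-\<^sup>l\<close> with \<open>l \<ge> 1\<close>: the
  series \<open>f\<close> lowers the exponent by \<open>m = k + l\<close> and \<open>g\<close> raises it again. This contributes
  \<open>f\<^sub>-\<^sub>m g\<^sub>m\<close>. A given \<open>m\<close> arises from the \<open>m\<close> values \<open>k = 0, \<dots>, m - 1\<close>, so that
  \<open>Tr T = \<Sum>\<^sub>m m (f\<^sub>-\<^sub>m g\<^sub>m - g\<^sub>-\<^sub>m f\<^sub>m)\<close>, where \<open>m\<close> runs over the positive integers.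
  The same sum is the residue \<open>\<Sum>\<^sub>i i f\<^sub>-\<^sub>i g\<^sub>i\<close> of \<open>f dg\<close>, with the terms of \<open>i = m\<close> and
  \<open>i = - m\<close> put together: the factor \<open>m\<close> that differentiation produces counts the
  monomials \<open>z\<^sup>k\<close> in \<open>V\<^sup>+\<close> that multiplication by \<open>z\<^sup>-\<^sup>m\<close> moves into \<open>V\<^sup>-\<close>.
\<close>

unbundle fps_syntax

section \<open>The trace of an endomorphism of finite rank\<close>

text \<open>
  This is \<open>Tr (U P) = Tr (P U)\<close> for \<open>T = U P\<close>, where \<open>P\<close> maps \<open>w\<close> to its coordinates
  \<open>\<phi> i w\<close> and \<open>U\<close> maps the \<open>i\<close>-th unit vector to \<open>T (e i)\<close>. For a basis \<open>B\<close> of the image, both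
  traces are the double sum of \<open>\<phi> i b\<close> times the \<open>b\<close>-coordinate of \<open>T (e i)\<close>. Thus the trace can be
  computed without knowing a basis of the image, and the \<open>e i\<close> need not lie in the image.
\<close>

lemma (in vector_space) finite_rank_trace_eq_sum:
  assumes W: "subspace W" and T: "Vector_Spaces.linear scale scale T"
    and I: "finite I" and e: "\<And>i. i \<in> I \<Longrightarrow> e i \<in> W"
    and \<phi>: "\<And>i. i \<in> I \<Longrightarrow> Vector_Spaces.linear scale (*) (\<phi> i)"
    and TW: "\<And>w. w \<in> W \<Longrightarrow> T w \<in> W"
    and expand: "\<And>w. w \<in> W \<Longrightarrow> T w = (\<Sum>i\<in>I. scale (\<phi> i w) (T (e i)))"
  shows "finite_rank_trace W T = (\<Sum>i\<in>I. \<phi> i (T (e i)))"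
proof -
  interpret T: Vector_Spaces.linear scale scale T by (fact T)
  have image_subspace: "subspace (T ` W)"
    using W by (rule T.subspace_image)
  define B where "B = (SOME B. independent B \<and> span B = T ` W)"
  have "\<exists>B. independent B \<and> span B = T ` W"
    using image_subspace by (metis maximal_independent_subset span_subspace)
  then have B: "independent B" "span B = T ` W"
    unfolding B_def by (metis (mono_tags, lifting) someI_ex)+
  have "B \<subseteq> span ((\<lambda>i. T (e i)) ` I)"
  proof
    fix b assume "b \<in> B"
    then obtain w where "w \<in> W" "b = T w" using B(2) span_base by blast
    then have "b = (\<Sum>i\<in>I. scale (\<phi> i w) (T (e i)))" by (simp only: expand)
    then show "b \<in> span ((\<lambda>i. T (e i)) ` I)"
      by (simp add: span_sum span_scale span_base)
  qed
  then have "finite B"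
    using independent_span_bound[OF _ B(1)] I by blast
  have BW: "b \<in> W" if "b \<in> B" for b
    using span_base[OF that] TW by (auto simp: B(2))
  have Te: "T (e i) \<in> span B" if "i \<in> I" for i
    using e[OF that] by (simp add: B(2))
  have trace_B: "representation B (T b) b = (\<Sum>i\<in>I. \<phi> i b * representation B (T (e i)) b)"
    if "b \<in> B" for b
    by (simp only: expand[OF BW[OF that]])
      (simp add: representation_sum representation_scale span_scale Te B(1))
  have \<phi>_T: "\<phi> i (T (e i)) = (\<Sum>b\<in>B. representation B (T (e i)) b * \<phi> i b)" if "i \<in> I" for i
  proof -
    interpret \<phi>: Vector_Spaces.linear scale "(*)" "\<phi> i" using \<phi> that by blast
    have "T (e i) = (\<Sum>b\<in>B. scale (representation B (T (e i)) b) b)"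
      using sum_representation_eq[OF B(1) Te[OF that] \<open>finite B\<close>] by simp
    then have "\<phi> i (T (e i)) = \<phi> i (\<Sum>b\<in>B. scale (representation B (T (e i)) b) b)"
      by (rule arg_cong)
    then show ?thesis by (simp add: \<phi>.sum \<phi>.scale)
  qed
  have "finite_rank_trace W T = (\<Sum>b\<in>B. representation B (T b) b)"
    by (simp add: finite_rank_trace_def B_def)
  also have "\<dots> = (\<Sum>b\<in>B. \<Sum>i\<in>I. representation B (T (e i)) b * \<phi> i b)"
    by (simp add: trace_B mult.commute)
  also have "\<dots> = (\<Sum>i\<in>I. \<phi> i (T (e i)))"
    by (subst sum.swap) (simp add: \<phi>_T)
  finally show ?thesis .
qed

section \<open>Projections, products and the coefficients of a Laurent series\<close>

lemma V_plus_iff: "v \<in> V_plus \<longleftrightarrow> (\<forall>n<0. v $$ n = 0)"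
proof
  assume "\<forall>n<0. v $$ n = 0"
  then have "v = fps_to_fls (fls_regpart v)"
    by (intro fls_eqI) simp
  then show "v \<in> V_plus" unfolding V_plus_def by blast
qed (auto simp: V_plus_def)

lemma nth_poly_X_inv:
  "poly (map_poly fls_const p) fls_X_inv $$ n = (if n \<le> 0 then coeff p (nat (- n)) else 0)"
  for p :: "'k::field poly"
proof (induction p arbitrary: n)
  case (pCons a p)
  have "nat (- n) = Suc (nat (- n - 1))" if "n < 0"
    using that by simp
  then show ?case
    using pCons.IH[of "n + 1"] pCons.hyps
    by (auto simp: map_poly_pCons fls_X_inv_times_conv_shift coeff_pCons split: nat.splits)
qed simp

lemma V_minus_iff: "v \<in> V_minus \<longleftrightarrow> (\<forall>n\<ge>0. v $$ n = 0)"
  for v :: "'k::field fls"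
proof
  assume v: "\<forall>n\<ge>0. v $$ n = 0"
  have "v = fls_X_inv * poly (map_poly fls_const (poly_shift 1 (fls_prpart v))) fls_X_inv"
    using v by (intro fls_eqI)
      (auto simp: fls_X_inv_times_conv_shift nth_poly_X_inv coeff_poly_shift)
  then show "v \<in> V_minus" unfolding V_minus_def by blast
qed (auto simp: V_minus_def fls_X_inv_times_conv_shift nth_poly_X_inv)

lemma proj_plus_eq: "proj_plus v = fps_to_fls (fls_regpart v)"
  for v :: "'k::field fls"
  unfolding proj_plus_def projection_along_def
proof (rule the_equality)
  fix a assume "a \<in> V_plus \<and> v - a \<in> V_minus"
  then show "a = fps_to_fls (fls_regpart v)"
    by (intro fls_eqI) (auto simp: V_plus_iff V_minus_iff)
qed (simp add: V_plus_iff V_minus_iff)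

lemma proj_minus_eq: "proj_minus v = v - fps_to_fls (fls_regpart v)"
  for v :: "'k::field fls"
  unfolding proj_minus_def projection_along_def
proof (rule the_equality)
  fix a assume "a \<in> V_minus \<and> v - a \<in> V_plus"
  then show "a = v - fps_to_fls (fls_regpart v)"
    by (intro fls_eqI) (auto simp: V_plus_iff V_minus_iff)
qed (simp add: V_plus_iff V_minus_iff)

lemma proj_plus_nth: "proj_plus v $$ n = (if n < 0 then 0 else v $$ n)"
  by (simp add: proj_plus_eq)

lemma proj_minus_nth: "proj_minus v $$ n = (if n < 0 then v $$ n else 0)"
  by (simp add: proj_minus_eq)

text \<open>
  The summation range is governed by lower bounds \<open>a\<close> and \<open>b\<close> for the exponents rather than by the
  subdegrees, so that one bound serves several series at once and the zero series needs no
  separate treatment.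
\<close>

lemma fls_times_nth_bounded:
  fixes f g :: "'k::field fls"
  assumes f: "\<And>n. n < a \<Longrightarrow> f $$ n = 0" and g: "\<And>n. n < b \<Longrightarrow> g $$ n = 0"
  shows "(f * g) $$ n = (\<Sum>i = a..n - b. f $$ i * g $$ (n - i))"
proof (cases "f = 0 \<or> g = 0")
  case False
  then have "a \<le> fls_subdegree f" "b \<le> fls_subdegree g"
    using f g by (meson nth_fls_subdegree_nonzero not_le)+
  then show ?thesis
    unfolding fls_times_nth(2)
    by (intro sum.mono_neutral_left) auto
qed auto

section \<open>The diagonal coefficients of the endomorphism\<close>

lemma linear_gamma_beta:
  "Vector_Spaces.linear fls_scale fls_scale (\<lambda>v. gamma f (beta g v) - gamma g (beta f v))"
proof
  have p: "proj_plus (u + v) = proj_plus u + proj_plus v"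
    "proj_minus (u + v) = proj_minus u + proj_minus v"
    "proj_plus (fls_scale c v) = fls_scale c (proj_plus v)"
    "proj_minus (fls_scale c v) = fls_scale c (proj_minus v)" for u v :: "'a fls" and c
    by (auto intro!: fls_eqI simp: proj_plus_nth proj_minus_nth fls_scale_def)
  have m: "f * fls_scale c v = fls_scale c (f * v)" for f v :: "'a fls" and c
    by (simp add: fls_scale_def mult.left_commute)
  show "gamma f (beta g (u + v)) - gamma g (beta f (u + v)) =
    gamma f (beta g u) - gamma g (beta f u) + (gamma f (beta g v) - gamma g (beta f v))" for u v
    by (simp add: gamma_def beta_def distrib_left p)
  show "gamma f (beta g (fls_scale c v)) - gamma g (beta f (fls_scale c v)) =
    fls_scale c (gamma f (beta g v) - gamma g (beta f v))" for c v
    by (simp add: gamma_def beta_def p m fls.scale_right_diff_distrib)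
qed

lemma linear_nth: "Vector_Spaces.linear fls_scale (*) (\<lambda>v. v $$ n)"
  by unfold_locales (simp_all add: fls_scale_def algebra_simps)

text \<open>Under these bounds the product \<open>f * v\<close> already lies in \<open>V\<^sup>+\<close>.\<close>

lemma beta_eq_0:
  assumes "\<And>n. n < - N \<Longrightarrow> f $$ n = 0" and "\<And>n. n < N \<Longrightarrow> v $$ n = 0"
  shows "beta f v = 0"
  by (rule fls_eqI)
    (simp add: beta_def proj_minus_nth fls_times_nth_bounded[of "- N" f N v, OF assms])

text \<open>
  The summand with index \<open>l\<close> is the path \<open>z\<^sup>k \<rightarrow> z\<^sup>-\<^sup>l \<rightarrow> z\<^sup>k\<close>. Paths with \<open>l > N\<close> contribute nothing:
  they need the coefficient of \<open>f\<close> at \<open>- (k + l) < - N\<close>.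
\<close>

lemma gamma_beta_nth:
  fixes f g :: "'k::field fls"
  assumes f: "\<And>n. n < - int N \<Longrightarrow> f $$ n = 0" and g: "\<And>n. n < - int N \<Longrightarrow> g $$ n = 0"
  shows "gamma g (beta f (fls_X ^ k)) $$ int k =
    (\<Sum>l = 1..N. f $$ (- int (k + l)) * g $$ int (k + l))"
proof -
  define h where "h = beta f (fls_X ^ k)"
  have h: "h $$ n = (if n < 0 then f $$ (n - int k) else 0)" for n
    by (simp add: h_def beta_def proj_minus_nth fls_X_power_times_conv_shift mult.commute[of f])
  have "gamma g h $$ int k = (h * g) $$ int k"
    by (simp add: gamma_def proj_plus_nth mult.commute)
  also have "\<dots> = (\<Sum>i = - int N..int k + int N. h $$ i * g $$ (int k - i))"
    using fls_times_nth_bounded[of "- int N" h "- int N" g "int k"] f g by (simp add: h)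
  also have "\<dots> = (\<Sum>i = - int N..-1. f $$ (i - int k) * g $$ (int k - i))"
    by (rule sum.mono_neutral_cong_right) (auto simp: h)
  also have "\<dots> = (\<Sum>l = 1..N. f $$ (- int (k + l)) * g $$ int (k + l))"
    by (rule sum.reindex_bij_witness[of _ "\<lambda>l. - int l" "\<lambda>i. nat (- i)"])
      (auto simp: algebra_simps)
  finally show ?thesis by (simp add: h_def)
qed

text \<open>An \<open>m \<le> N\<close> has exactly \<open>m\<close> decompositions \<open>k + l\<close> with \<open>k \<ge> 0\<close> and \<open>l \<ge> 1\<close>.\<close>

lemma sum_antidiagonals:
  fixes a :: "nat \<Rightarrow> 'a::comm_semiring_1"
  assumes "\<And>m. m > N \<Longrightarrow> a m = 0"
  shows "(\<Sum>k<N. \<Sum>l = 1..N. a (k + l)) = (\<Sum>m = 1..N. of_nat m * a m)"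
proof -
  have "(\<Sum>l = 1..N. a (k + l)) = (\<Sum>m = 1..N. if k < m then a m else 0)" for k
  proof -
    have "(\<Sum>l = 1..N. a (k + l)) = (\<Sum>m = k + 1..k + N. a m)"
      using sum.shift_bounds_cl_nat_ivl[of a 1 k N] by (simp add: add.commute)
    also have "\<dots> = (\<Sum>m = k + 1..N. a m)"
      using assms by (intro sum.mono_neutral_right) auto
    also have "\<dots> = (\<Sum>m = 1..N. if k < m then a m else 0)"
      by (rule sum.mono_neutral_cong_left) auto
    finally show ?thesis .
  qed
  then have "(\<Sum>k<N. \<Sum>l = 1..N. a (k + l)) = (\<Sum>m = 1..N. \<Sum>k<N. if k < m then a m else 0)"
    by (simp add: sum.swap[of _ "{..<N}"])
  also have "\<dots> = (\<Sum>m = 1..N. \<Sum>k<m. a m)"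
    by (intro sum.cong refl sum.mono_neutral_cong_right) auto
  finally show ?thesis by simp
qed

section \<open>The residue as a trace\<close>

text \<open>
  The terms of \<open>\<Sum>\<^sub>i - i f\<^sub>i g\<^sub>-\<^sub>i\<close> are folded along \<open>i \<mapsto> - i\<close>, to match the two summands of
  \<open>\<gamma>\<^sub>2 \<beta>\<^sub>1 - \<gamma>\<^sub>1 \<beta>\<^sub>2\<close>.
\<close>

lemma fls_residue_times_deriv:
  fixes f g :: "'k::field fls"
  assumes f: "\<And>n. n < - int N \<Longrightarrow> f $$ n = 0" and g: "\<And>n. n < - int N \<Longrightarrow> g $$ n = 0"
  shows "fls_residue (f * fls_deriv g) = (\<Sum>m = 1..N. of_nat m *
    (f $$ (- int m) * g $$ int m - g $$ (- int m) * f $$ int m))"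
proof -
  define c where "c i = of_int (- i) * (f $$ i * g $$ (- i))" for i
  \<comment> \<open>Differentiation lowers the bound for \<open>g\<close> by one, so the range ends at \<open>-1 - (- N - 1) = N\<close>.\<close>
  have "fls_residue (f * fls_deriv g) = (\<Sum>i = - int N..int N. c i)"
    using fls_times_nth_bounded[of "- int N" f "- int N - 1" "fls_deriv g" "-1"] f g
    by (simp add: c_def mult.left_commute)
  also have "{- int N..int N} = {- int N..-1} \<union> {0} \<union> {1..int N}" by auto
  also have "(\<Sum>i\<in>\<dots>. c i) = (\<Sum>i = - int N..-1. c i) + (\<Sum>i = 1..int N. c i)"
    by (simp add: sum.union_disjoint c_def)
  also have "(\<Sum>i = - int N..-1. c i) = (\<Sum>m = 1..N. c (- int m))"
    by (rule sum.reindex_bij_witness[of _ "\<lambda>l. - int l" "\<lambda>i. nat (- i)"]) auto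
  also have "(\<Sum>i = 1..int N. c i) = (\<Sum>m = 1..N. c (int m))"
    by (rule sum.reindex_bij_witness[of _ int nat]) auto
  finally show ?thesis
    by (simp add: c_def algebra_simps flip: sum.distrib)
qed

text \<open>
  The formula on \<open>V\<close> itself, for arbitrary series \<open>f\<close> and \<open>g\<close>; the geometric statement is its
  instance at the expansions of \<open>f\<^sub>1\<close> and \<open>f\<^sub>2\<close>.
\<close>

lemma fls_residue_eq_trace:
  fixes f g :: "'k::field fls"
  shows "fls_residue (f * fls_deriv g) =
    fls_finite_rank_trace V_plus (\<lambda>v. gamma g (beta f v) - gamma f (beta g v))"
proof -
  define N where "N = nat (max (- fls_subdegree f) (- fls_subdegree g))"
  have f: "f $$ n = 0" and g: "g $$ n = 0" if "n < - int N" for n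
  proof -
    have "n < fls_subdegree f" "n < fls_subdegree g"
      using that unfolding N_def by linarith+
    then show "f $$ n = 0" "g $$ n = 0" by auto
  qed
  define T where "T v = gamma g (beta f v) - gamma f (beta g v)" for v
  have T: "Vector_Spaces.linear fls_scale fls_scale T"
    unfolding T_def by (rule linear_gamma_beta)
  interpret T: Vector_Spaces.linear fls_scale fls_scale T by (fact T)
  have expand: "T v = (\<Sum>k<N. fls_scale (v $$ int k) (T (fls_X ^ k)))" if "v \<in> V_plus" for v
  proof -
    \<comment> \<open>Truncating \<open>v\<close> at exponent \<open>N\<close> changes it by an element of \<open>z\<^sup>N V\<^sup>+\<close>, which \<open>T\<close> kills.\<close>
    define u where "u = (\<Sum>k<N. fls_scale (v $$ int k) (fls_X ^ k))"
    have u_nth: "u $$ n = (\<Sum>k<N. if n = int k then v $$ n else 0)" for n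
    proof -
      have "u $$ n = (\<Sum>k<N. fls_scale (v $$ int k) (fls_X ^ k) $$ n)"
        unfolding u_def by (rule fls_nth_sum)
      also have "\<dots> = (\<Sum>k<N. if n = int k then v $$ n else 0)"
        by (intro sum.cong) (auto simp: fls_scale_def)
      finally show ?thesis .
    qed
    have "u $$ n = v $$ n" if "n < int N" for n
      using that \<open>v \<in> V_plus\<close>
      by (cases n) (auto simp: u_nth V_plus_iff sum.neutral)
    then have "beta f (v - u) = 0" "beta g (v - u) = 0"
      using f g by (auto intro!: beta_eq_0[of "int N"])
    then have "T (v - u) = 0"
      by (simp add: T_def gamma_def)
    then have "T v = T u" by (simp add: T.diff)
    then show ?thesis by (simp add: u_def T.sum T.scale)
  qed
  have "fls_finite_rank_trace V_plus T = (\<Sum>k<N. T (fls_X ^ k) $$ int k)"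
  proof (rule fls.finite_rank_trace_eq_sum[OF _ T])
    show "fls.subspace V_plus"
      by (auto simp: fls.subspace_def V_plus_iff fls_scale_def)
    show "T v = (\<Sum>k<N. fls_scale (v $$ int k) (T (fls_X ^ k)))" if "v \<in> V_plus" for v
      using that by (rule expand)
  qed (auto simp: linear_nth V_plus_iff T_def gamma_def proj_plus_nth)
  also have "\<dots> = (\<Sum>k<N. \<Sum>l = 1..N. f $$ (- int (k + l)) * g $$ int (k + l)
      - g $$ (- int (k + l)) * f $$ int (k + l))"
    by (simp add: T_def gamma_beta_nth[OF f g] gamma_beta_nth[OF g f] sum_subtractf)
  also have "\<dots> = (\<Sum>m = 1..N. of_nat m *
    (f $$ (- int m) * g $$ int m - g $$ (- int m) * f $$ int m))"
    by (rule sum_antidiagonals) (simp add: f g)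
  also have "\<dots> = fls_residue (f * fls_deriv g)"
    using fls_residue_times_deriv[OF f g] by simp
  finally show ?thesis
    unfolding T_def[abs_def] by (rule sym)
qed

theorem corollary4p11:
  fixes \<iota> :: "'k::field \<Rightarrow> 'F::field"
    and x :: "'F \<Rightarrow> int"
    and j :: "'F \<Rightarrow> 'K::field"
    and A\<^sub>x :: "'K set"
    and z\<^sub>x f\<^sub>1 f\<^sub>2 :: 'K
  assumes "perfect_field TYPE('k)"
    and "function_field \<iota>"
    and "algebraically_closed_in \<iota>"
    and "rational_point \<iota> x"
    and "completed_local_ring x j A\<^sub>x"
    and "fraction_field_of A\<^sub>x"
    and "formal_parameter A\<^sub>x z\<^sub>x"
    and "f\<^sub>1 \<noteq> 0" and "f\<^sub>2 \<noteq> 0"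
  shows "let F\<^sub>1 = laurent_expansion A\<^sub>x (j \<circ> \<iota>) z\<^sub>x f\<^sub>1;
             F\<^sub>2 = laurent_expansion A\<^sub>x (j \<circ> \<iota>) z\<^sub>x f\<^sub>2
         in residue A\<^sub>x (j \<circ> \<iota>) z\<^sub>x f\<^sub>1 f\<^sub>2 =
            fls_finite_rank_trace V_plus (\<lambda>v. gamma F\<^sub>2 (beta F\<^sub>1 v) - gamma F\<^sub>1 (beta F\<^sub>2 v))"
  unfolding Let_def residue_def by (rule fls_residue_eq_trace)

end
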